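(* Let $Q$ be a quandle, $S$ be a set and $\alpha:Q\times Q\to \Sigma_{|S|}$ be a constant quandle cocycle. Then there exists an embedding (injective group homomorphism) $(\mathrm{Aut}(Q)\times \Sigma_{|S|})_{\alpha}\hookrightarrow \mathrm{Aut}(Q\times_{\alpha}S)$.
   Context: A quandle is a set $Q$ with a binary operation $*$ such that (1) $x*x=x$ for all $x\in Q$; (2) for every $x\in Q$ the map $y\mapsto y*x$ is a bijection of $Q$; (3) $(x*y)*z=(x*z)*(y*z)$ for all $x,y,z\in Q$. $\mathrm{Aut}(Q)$ is the group of bijections $\varphi$ of $Q$ with $\varphi(x*y)=\varphi(x)*\varphi(y)$ for all $x,y$. $\Sigma_{|S|}$ denotes the group of all permutations of the set $S$. A constant quandle cocycle is a map $\alpha:Q\times Q\to\Sigma_{|S|}$ such that $\alpha(x*y,z)\alpha(x,y)=\alpha(x*z,y*z)\alpha(x,z)$ for all $x,y,z\in Q$ and $\alpha(x,x)=\mathrm{id}_S$ for all $x\in Q$; the set of these is denoted $\mathcal{C}^2(Q,S)$. The non-abelian extension $Q\times_\alpha S$ is the quandle with underlying set $Q\times S$ and operation $(x,t)*(y,s)=(x*y,\alpha(x,y)(t))$. The group $\mathrm{Aut}(Q)\times\Sigma_{|S|}$ acts on $\mathcal{C}^2(Q,S)$ from the left by ${}^{(\phi,\theta)}\alpha(x,y)=\theta\,\alpha(\phi^{-1}(x),\phi^{-1}(y))\,\theta^{-1}$, and $(\mathrm{Aut}(Q)\times \Sigma_{|S|})_{\alpha}$ denotes the stabilizer of $\alpha$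 under this action.
   Formalization: The quandle Q and the set S are assumed nonempty; otherwise the claim fails, e.g. for Q empty and |S| = 2 the stabilizer is the group of order 2 while Aut of the empty extension is trivial. *)

theory Defs
  imports "HOL-Algebra.Group_Action"
begin

section \<open>Quandles and their automorphism groups\<close>

record 'a magma = "'a partial_object" +
  qop :: "['a, 'a] \<Rightarrow> 'a" (infixl \<open>\<star>\<index>\<close> 70)

locale quandle =
  fixes Q (structure)
  assumes qop_closed: "\<lbrakk>x \<in> carrier Q; y \<in> carrier Q\<rbrakk> \<Longrightarrow> x \<star> y \<in> carrier Q"
    and qop_idem: "x \<in> carrier Q \<Longrightarrow> x \<star> x = x"
    and qop_bij: "x \<in> carrier Q \<Longrightarrow> bij_betw (\<lambda>y. y \<star> x) (carrier Q) (carrier Q)"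
    and qop_distrib: "\<lbrakk>x \<in> carrier Q; y \<in> carrier Q; z \<in> carrier Q\<rbrakk>
      \<Longrightarrow> (x \<star> y) \<star> z = (x \<star> z) \<star> (y \<star> z)"

definition quandle_auto :: "('a, 'm) magma_scheme \<Rightarrow> ('a \<Rightarrow> 'a) set"
  where "quandle_auto Q = {\<phi> \<in> Bij (carrier Q).
    \<forall>x \<in> carrier Q. \<forall>y \<in> carrier Q. \<phi> (x \<star>\<^bsub>Q\<^esub> y) = \<phi> x \<star>\<^bsub>Q\<^esub> \<phi> y}"

definition QuandleAut :: "('a, 'm) magma_scheme \<Rightarrow> ('a \<Rightarrow> 'a) monoid"
  where "QuandleAut Q = BijGroup (carrier Q) \<lparr>carrier := quandle_auto Q\<rparr>"


section \<open>Constant cocycles and non-abelian extensions\<close>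

text \<open>The symmetric group of a set \<open>S\<close> is \<^const>\<open>BijGroup\<close> \<open>S\<close>, whose product is composition
  with the right factor applied first. Cocycles are taken to be extensional, so that
  equality of cocycles (in particular in the stabilizer below) is equality on \<open>Q \<times> Q\<close>.\<close>

definition constant_cocycles ::
    "('a, 'm) magma_scheme \<Rightarrow> 's set \<Rightarrow> ('a \<times> 'a \<Rightarrow> 's \<Rightarrow> 's) set"
  where "constant_cocycles Q S =
    {\<alpha> \<in> carrier Q \<times> carrier Q \<rightarrow>\<^sub>E carrier (BijGroup S).
      (\<forall>x \<in> carrier Q. \<forall>y \<in> carrier Q. \<forall>z \<in> carrier Q.
        \<alpha> (x \<star>\<^bsub>Q\<^esub> y, z) \<otimes>\<^bsub>BijGroup S\<^esub> \<alpha> (x, y)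
          = \<alpha> (x \<star>\<^bsub>Q\<^esub> z, y \<star>\<^bsub>Q\<^esub> z) \<otimes>\<^bsub>BijGroup S\<^esub> \<alpha> (x, z)) \<and>
      (\<forall>x \<in> carrier Q. \<alpha> (x, x) = \<one>\<^bsub>BijGroup S\<^esub>)}"

definition quandle_ext ::
    "('a, 'm) magma_scheme \<Rightarrow> ('a \<times> 'a \<Rightarrow> 's \<Rightarrow> 's) \<Rightarrow> 's set \<Rightarrow> ('a \<times> 's) magma"
  where "quandle_ext Q \<alpha> S =
    \<lparr>carrier = carrier Q \<times> S,
     qop = (\<lambda>(x, t) (y, s). (x \<star>\<^bsub>Q\<^esub> y, \<alpha> (x, y) t))\<rparr>"


section \<open>The action on constant cocycles\<close>

definition cocycle_action ::
    "('a, 'm) magma_scheme \<Rightarrow> 's set \<Rightarrow> ('a \<Rightarrow> 'a) \<times> ('s \<Rightarrow> 's)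
      \<Rightarrow> ('a \<times> 'a \<Rightarrow> 's \<Rightarrow> 's) \<Rightarrow> ('a \<times> 'a \<Rightarrow> 's \<Rightarrow> 's)"
  where "cocycle_action Q S = (\<lambda>(\<phi>, \<theta>). \<lambda>\<alpha> \<in> constant_cocycles Q S.
    \<lambda>(x, y) \<in> carrier Q \<times> carrier Q.
      \<theta> \<otimes>\<^bsub>BijGroup S\<^esub>
      \<alpha> ((inv\<^bsub>QuandleAut Q\<^esub> \<phi>) x, (inv\<^bsub>QuandleAut Q\<^esub> \<phi>) y) \<otimes>\<^bsub>BijGroup S\<^esub>
      inv\<^bsub>BijGroup S\<^esub> \<theta>)"

definition cocycle_stabilizer ::
    "('a, 'm) magma_scheme \<Rightarrow> 's set \<Rightarrow> ('a \<times> 'a \<Rightarrow> 's \<Rightarrow> 's)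
      \<Rightarrow> (('a \<Rightarrow> 'a) \<times> ('s \<Rightarrow> 's)) monoid"
  where "cocycle_stabilizer Q S \<alpha> = (QuandleAut Q \<times>\<times> BijGroup S)
    \<lparr>carrier := stabilizer (QuandleAut Q \<times>\<times> BijGroup S) (cocycle_action Q S) \<alpha>\<rparr>"

end

theory Submission
  imports Defs
begin

text \<open>A pair \<open>(\<phi>, \<theta>)\<close> fixes \<open>\<alpha>\<close> if and only if \<open>\<theta> \<circ> \<alpha>(x, y) = \<alpha>(\<phi> x, \<phi> y) \<circ> \<theta>\<close> for all
  \<open>x\<close> and \<open>y\<close>, and this is precisely the condition for the product map
  \<open>(x, t) \<mapsto> (\<phi> x, \<theta> t)\<close> to preserve the operation of \<open>Q \<times>\<^sub>\<alpha> S\<close>. Sending a pair to its product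
  map is multiplicative, and it is injective because \<open>Q\<close> and \<open>S\<close> are nonempty.\<close>

section \<open>Permutation groups evaluated at points\<close>

lemma carrier_BijGroup: "carrier (BijGroup S) = Bij S"
  by (simp add: BijGroup_def)

lemma BijGroup_mult_apply:
  "\<lbrakk>g \<in> Bij S; f \<in> Bij S; x \<in> S\<rbrakk> \<Longrightarrow> (g \<otimes>\<^bsub>BijGroup S\<^esub> f) x = g (f x)"
  by (simp add: BijGroup_def compose_eq)

lemma BijGroup_inv_apply:
  assumes "f \<in> Bij S" "x \<in> S"
  shows "(inv\<^bsub>BijGroup S\<^esub> f) (f x) = x" and "f ((inv\<^bsub>BijGroup S\<^esub> f) x) = x"
proof -
  interpret B: group "BijGroup S" by (rule group_BijGroup)
  have f: "f \<in> carrier (BijGroup S)" using assms by (simp add: BijGroup_def)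
  have i: "inv\<^bsub>BijGroup S\<^esub> f \<in> Bij S"
    using B.inv_closed[OF f] by (simp only: carrier_BijGroup)
  have one: "\<one>\<^bsub>BijGroup S\<^esub> x = x" using assms by (simp add: BijGroup_def)
  show "(inv\<^bsub>BijGroup S\<^esub> f) (f x) = x"
    using B.l_inv[OF f] one BijGroup_mult_apply[OF i assms] by simp
  show "f ((inv\<^bsub>BijGroup S\<^esub> f) x) = x"
    using B.r_inv[OF f] one BijGroup_mult_apply[OF assms(1) i assms(2)] by simp
qed

lemma Bij_closed: "\<lbrakk>f \<in> Bij S; x \<in> S\<rbrakk> \<Longrightarrow> f x \<in> S"
  using Bij_imp_funcset by blast

lemma BijGroup_inv_closed: "f \<in> Bij S \<Longrightarrow> inv\<^bsub>BijGroup S\<^esub> f \<in> Bij S"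
  using group.inv_closed[OF group_BijGroup, of f S] by (simp add: carrier_BijGroup)

text \<open>Members of \<open>Bij S\<close> are extensional, so off \<open>S\<close> both functions
  take the same default value.\<close>

lemma Bij_eqI:
  assumes "f \<in> Bij S" "g \<in> Bij S" "\<And>x. x \<in> S \<Longrightarrow> f x = g x"
  shows "f = g"
  using assms by (auto intro: extensionalityI Bij_imp_extensional)

section \<open>The automorphism group of a magma with closed operation\<close>

lemma subgroup_quandle_auto:
  assumes closed: "\<And>x y. \<lbrakk>x \<in> carrier Q; y \<in> carrier Q\<rbrakk> \<Longrightarrow> x \<star>\<^bsub>Q\<^esub> y \<in> carrier Q"
  shows "subgroup (quandle_auto Q) (BijGroup (carrier Q))"
proof -
  interpret B: group "BijGroup (carrier Q)" by (rule group_BijGroup)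
  show ?thesis
  proof
    show "quandle_auto Q \<subseteq> carrier (BijGroup (carrier Q))"
      by (auto simp: quandle_auto_def carrier_BijGroup)
  next
    fix f g assume "f \<in> quandle_auto Q" "g \<in> quandle_auto Q"
    then have f: "f \<in> Bij (carrier Q)"
        "\<And>x y. \<lbrakk>x \<in> carrier Q; y \<in> carrier Q\<rbrakk> \<Longrightarrow> f (x \<star>\<^bsub>Q\<^esub> y) = f x \<star>\<^bsub>Q\<^esub> f y"
      and g: "g \<in> Bij (carrier Q)"
        "\<And>x y. \<lbrakk>x \<in> carrier Q; y \<in> carrier Q\<rbrakk> \<Longrightarrow> g (x \<star>\<^bsub>Q\<^esub> y) = g x \<star>\<^bsub>Q\<^esub> g y"
      by (auto simp: quandle_auto_def)
    have "f \<otimes>\<^bsub>BijGroup (carrier Q)\<^esub> g \<in> Bij (carrier Q)"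
      using B.m_closed[of f g] f(1) g(1) by (simp add: carrier_BijGroup)
    then show "f \<otimes>\<^bsub>BijGroup (carrier Q)\<^esub> g \<in> quandle_auto Q"
      using f g by (simp add: quandle_auto_def BijGroup_mult_apply closed Bij_closed)
  next
    show "\<one>\<^bsub>BijGroup (carrier Q)\<^esub> \<in> quandle_auto Q"
      using B.one_closed by (simp add: quandle_auto_def closed BijGroup_def)
  next
    fix f assume "f \<in> quandle_auto Q"
    then have f: "f \<in> Bij (carrier Q)"
        "\<And>x y. \<lbrakk>x \<in> carrier Q; y \<in> carrier Q\<rbrakk> \<Longrightarrow> f (x \<star>\<^bsub>Q\<^esub> y) = f x \<star>\<^bsub>Q\<^esub> f y"
      by (auto simp: quandle_auto_def)
    let ?i = "inv\<^bsub>BijGroup (carrier Q)\<^esub> f"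
    have i: "?i \<in> Bij (carrier Q)" by (rule BijGroup_inv_closed[OF f(1)])
    have "?i (x \<star>\<^bsub>Q\<^esub> y) = ?i x \<star>\<^bsub>Q\<^esub> ?i y" if "x \<in> carrier Q" "y \<in> carrier Q" for x y
    proof -
      have c: "?i x \<in> carrier Q" "?i y \<in> carrier Q" using i that by (simp_all add: Bij_closed)
      \<comment> \<open>Multiplicativity is known for \<open>f\<close> only, so the claimed equation
        is first proved after applying \<open>f\<close>; applying \<open>?i\<close> to both sides
        then gives the claim.\<close>
      have "x \<star>\<^bsub>Q\<^esub> y = f (?i x \<star>\<^bsub>Q\<^esub> ?i y)"
        using that c by (simp add: f BijGroup_inv_apply)
      then show ?thesis using c closed f(1) by (simp add: BijGroup_inv_apply)
    qed
    then show "?i \<in> quandle_auto Q" using i by (simp add: quandle_auto_def)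
  qed
qed

text \<open>The hypothesis is closure alone so that the lemma serves both \<open>Q\<close> and the
  extension, for which \<open>quandle_ext_closed\<close> supplies it.\<close>

lemma group_QuandleAut:
  assumes "\<And>x y. \<lbrakk>x \<in> carrier Q; y \<in> carrier Q\<rbrakk> \<Longrightarrow> x \<star>\<^bsub>Q\<^esub> y \<in> carrier Q"
  shows "group (QuandleAut Q)"
  unfolding QuandleAut_def
  by (rule group.subgroup_imp_group[OF group_BijGroup subgroup_quandle_auto[OF assms]])

text \<open>Inverses in a subgroup are those of the ambient group. This makes the cancellation rules
  \<open>BijGroup_inv_apply\<close> available for the inverse that occurs in
  \<open>cocycle_action\<close>.\<close>

lemma QuandleAut_inv:
  assumes "\<And>x y. \<lbrakk>x \<in> carrier Q; y \<in> carrier Q\<rbrakk> \<Longrightarrow> x \<star>\<^bsub>Q\<^esub> y \<in> carrier Q"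
    and "\<phi> \<in> quandle_auto Q"
  shows "inv\<^bsub>QuandleAut Q\<^esub> \<phi> = inv\<^bsub>BijGroup (carrier Q)\<^esub> \<phi>"
  unfolding QuandleAut_def
  by (rule group.m_inv_consistent[OF group_BijGroup subgroup_quandle_auto[OF assms(1)] assms(2)])

section \<open>Cocycles, the extension and the stabilizer\<close>

lemma constant_cocycles_PiE:
  assumes "\<alpha> \<in> constant_cocycles Q S"
  shows "\<alpha> \<in> carrier Q \<times> carrier Q \<rightarrow>\<^sub>E Bij S"
proof -
  have "\<alpha> \<in> carrier Q \<times> carrier Q \<rightarrow>\<^sub>E carrier (BijGroup S)"
    using assms unfolding constant_cocycles_def by blast
  then show ?thesis by (simp add: carrier_BijGroup)
qed

lemma constant_cocycle_Bij:
  "\<lbrakk>\<alpha> \<in> constant_cocycles Q S; x \<in> carrier Q; y \<in> carrier Q\<rbrakk> \<Longrightarrow> \<alpha> (x, y) \<in> Bij S"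
  by (rule PiE_mem[OF constant_cocycles_PiE]) auto

lemma quandle_ext_closed:
  assumes "quandle Q" "\<alpha> \<in> constant_cocycles Q S"
    and "p \<in> carrier (quandle_ext Q \<alpha> S)" "q \<in> carrier (quandle_ext Q \<alpha> S)"
  shows "p \<star>\<^bsub>quandle_ext Q \<alpha> S\<^esub> q \<in> carrier (quandle_ext Q \<alpha> S)"
  using assms(3,4) quandle.qop_closed[OF assms(1)] constant_cocycle_Bij[OF assms(2)]
  by (auto simp: quandle_ext_def Bij_closed)

text \<open>The fixed-point equation contains both inverses. Multiplying by \<theta> on the right
  removes one, replacing x, y by their images under \<phi> removes the other, and evaluation at t
  turns products into compositions. All later arguments use the resulting inverse-free
  condition.\<close>

lemma mem_cocycle_stabilizer_iff:
  assumes Q: "quandle Q" and \<alpha>: "\<alpha> \<in> constant_cocycles Q S"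
  shows "(\<phi>, \<theta>) \<in> carrier (cocycle_stabilizer Q S \<alpha>) \<longleftrightarrow>
    \<phi> \<in> quandle_auto Q \<and> \<theta> \<in> Bij S \<and>
    (\<forall>x \<in> carrier Q. \<forall>y \<in> carrier Q. \<forall>t \<in> S. \<theta> (\<alpha> (x, y) t) = \<alpha> (\<phi> x, \<phi> y) (\<theta> t))"
proof (cases "\<phi> \<in> quandle_auto Q \<and> \<theta> \<in> Bij S")
  case False
  then show ?thesis
    by (auto simp: cocycle_stabilizer_def stabilizer_def QuandleAut_def carrier_BijGroup)
next
  case True
  interpret B: group "BijGroup S" by (rule group_BijGroup)
  let ?i = "inv\<^bsub>BijGroup (carrier Q)\<^esub> \<phi>"
  let ?m = "(\<otimes>\<^bsub>BijGroup S\<^esub>)"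
  have \<phi>: "\<phi> \<in> Bij (carrier Q)" using True by (simp add: quandle_auto_def)
  have i: "?i \<in> Bij (carrier Q)" by (rule BijGroup_inv_closed[OF \<phi>])
  have \<theta>: "\<theta> \<in> carrier (BijGroup S)" using True by (simp add: carrier_BijGroup)
  have \<alpha>B: "\<alpha> (x, y) \<in> carrier (BijGroup S)" if "x \<in> carrier Q" "y \<in> carrier Q" for x y
    using constant_cocycle_Bij[OF \<alpha> that] by (simp add: carrier_BijGroup)
  \<comment> \<open>Both \<alpha> and its image under the action are \<open>undefined\<close> off Q
    x Q, so their equality as functions is decided by their values on Q x Q.\<close>
  have \<alpha>E: "\<alpha> \<in> extensional (carrier Q \<times> carrier Q)"
    using constant_cocycles_PiE[OF \<alpha>] by (simp add: PiE_def)
  have inv\<phi>: "inv\<^bsub>QuandleAut Q\<^esub> \<phi> = ?i"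
    by (rule QuandleAut_inv[OF quandle.qop_closed[OF Q]]) (simp_all add: True)
  \<comment> \<open>The action is a function restricted to \<open>constant_cocycles Q S\<close>;
    membership of \<alpha> is what allows its value to be unfolded.\<close>
  have act: "cocycle_action Q S (\<phi>, \<theta>) \<alpha> =
      (\<lambda>(x, y) \<in> carrier Q \<times> carrier Q. ?m (?m \<theta> (\<alpha> (?i x, ?i y))) (inv\<^bsub>BijGroup S\<^esub> \<theta>))"
    using \<alpha> by (simp add: cocycle_action_def inv\<phi>)
  have "(\<phi>, \<theta>) \<in> carrier (cocycle_stabilizer Q S \<alpha>) \<longleftrightarrow> cocycle_action Q S (\<phi>, \<theta>) \<alpha> = \<alpha>"
    using True by (simp add: cocycle_stabilizer_def stabilizer_def QuandleAut_def carrier_BijGroup)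
  also have "\<dots> \<longleftrightarrow> (\<forall>x \<in> carrier Q. \<forall>y \<in> carrier Q.
      ?m (?m \<theta> (\<alpha> (?i x, ?i y))) (inv\<^bsub>BijGroup S\<^esub> \<theta>) = \<alpha> (x, y))"
    unfolding act
  proof (intro iffI ballI)
    assume "\<forall>x \<in> carrier Q. \<forall>y \<in> carrier Q.
      ?m (?m \<theta> (\<alpha> (?i x, ?i y))) (inv\<^bsub>BijGroup S\<^esub> \<theta>) = \<alpha> (x, y)"
    then show "(\<lambda>(x, y) \<in> carrier Q \<times> carrier Q.
        ?m (?m \<theta> (\<alpha> (?i x, ?i y))) (inv\<^bsub>BijGroup S\<^esub> \<theta>)) = \<alpha>"
      by (intro extensionalityI[OF restrict_extensional \<alpha>E]) auto
  next
    fix x y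
    assume eq: "(\<lambda>(x, y) \<in> carrier Q \<times> carrier Q.
        ?m (?m \<theta> (\<alpha> (?i x, ?i y))) (inv\<^bsub>BijGroup S\<^esub> \<theta>)) = \<alpha>"
      and xy: "x \<in> carrier Q" "y \<in> carrier Q"
    show "?m (?m \<theta> (\<alpha> (?i x, ?i y))) (inv\<^bsub>BijGroup S\<^esub> \<theta>) = \<alpha> (x, y)"
      using fun_cong[OF eq, of "(x, y)"] xy by simp
  qed
  also have "\<dots> \<longleftrightarrow> (\<forall>x \<in> carrier Q. \<forall>y \<in> carrier Q.
      ?m \<theta> (\<alpha> (?i x, ?i y)) = ?m (\<alpha> (x, y)) \<theta>)"
    by (intro ball_cong refl B.inv_solve_right' B.m_closed \<theta> \<alpha>B Bij_closed[OF i])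
  \<comment> \<open>Change of variables: since \<phi> permutes Q, the condition for all x, y is
    instantiated at their images under \<phi> in one direction and under \<open>?i\<close> in the
    other.\<close>
  also have "\<dots> \<longleftrightarrow> (\<forall>x \<in> carrier Q. \<forall>y \<in> carrier Q. ?m \<theta> (\<alpha> (x, y)) = ?m (\<alpha> (\<phi> x, \<phi> y)) \<theta>)"
    (is "?L = ?R")
  proof (intro iffI ballI)
    fix x y assume ?L "x \<in> carrier Q" "y \<in> carrier Q"
    then have "?m \<theta> (\<alpha> (?i (\<phi> x), ?i (\<phi> y))) = ?m (\<alpha> (\<phi> x, \<phi> y)) \<theta>"
      using Bij_closed[OF \<phi>] by blast
    then show "?m \<theta> (\<alpha> (x, y)) = ?m (\<alpha> (\<phi> x, \<phi> y)) \<theta>"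
      using \<open>x \<in> carrier Q\<close> \<open>y \<in> carrier Q\<close> by (simp only: BijGroup_inv_apply(1)[OF \<phi>])
  next
    fix x y assume ?R "x \<in> carrier Q" "y \<in> carrier Q"
    then have "?m \<theta> (\<alpha> (?i x, ?i y)) = ?m (\<alpha> (\<phi> (?i x), \<phi> (?i y))) \<theta>"
      using Bij_closed[OF i] by blast
    then show "?m \<theta> (\<alpha> (?i x, ?i y)) = ?m (\<alpha> (x, y)) \<theta>"
      using \<open>x \<in> carrier Q\<close> \<open>y \<in> carrier Q\<close> by (simp only: BijGroup_inv_apply(2)[OF \<phi>])
  qed
  also have "\<dots> \<longleftrightarrow> (\<forall>x \<in> carrier Q. \<forall>y \<in> carrier Q. \<forall>t \<in> S.
      \<theta> (\<alpha> (x, y) t) = \<alpha> (\<phi> x, \<phi> y) (\<theta> t))"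
  proof (intro ball_cong refl)
    fix x y assume xy: "x \<in> carrier Q" "y \<in> carrier Q"
    note a = \<alpha>B[OF xy] \<alpha>B[OF Bij_closed[OF \<phi> xy(1)] Bij_closed[OF \<phi> xy(2)]]
    have m: "?m \<theta> (\<alpha> (x, y)) \<in> Bij S" "?m (\<alpha> (\<phi> x, \<phi> y)) \<theta> \<in> Bij S"
      using B.m_closed[OF \<theta> a(1)] B.m_closed[OF a(2) \<theta>] by (simp_all add: carrier_BijGroup)
    have a': "\<alpha> (x, y) \<in> Bij S" "\<alpha> (\<phi> x, \<phi> y) \<in> Bij S" using a by (simp_all add: carrier_BijGroup)
    have "?m \<theta> (\<alpha> (x, y)) = ?m (\<alpha> (\<phi> x, \<phi> y)) \<theta> \<longleftrightarrow>
        (\<forall>t \<in> S. ?m \<theta> (\<alpha> (x, y)) t = ?m (\<alpha> (\<phi> x, \<phi> y)) \<theta> t)"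
      using Bij_eqI[OF m] by auto
    then show "?m \<theta> (\<alpha> (x, y)) = ?m (\<alpha> (\<phi> x, \<phi> y)) \<theta> \<longleftrightarrow>
        (\<forall>t \<in> S. \<theta> (\<alpha> (x, y) t) = \<alpha> (\<phi> x, \<phi> y) (\<theta> t))"
      using True a' by (simp add: BijGroup_mult_apply)
  qed
  finally show ?thesis using True by simp
qed

text \<open>The subgroup properties are checked directly on the intertwining condition, which passes
  to products and inverses; the proof does not go through a group action.\<close>

lemma group_cocycle_stabilizer:
  assumes Q: "quandle Q" and \<alpha>: "\<alpha> \<in> constant_cocycles Q S"
  shows "group (cocycle_stabilizer Q S \<alpha>)"
proof -
  let ?G = "QuandleAut Q \<times>\<times> BijGroup S"
  let ?C = "carrier (cocycle_stabilizer Q S \<alpha>)"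
  note closed = quandle.qop_closed[OF Q]
  interpret A: group "QuandleAut Q" by (rule group_QuandleAut[OF closed])
  interpret B: group "BijGroup S" by (rule group_BijGroup)
  interpret G: group ?G by (intro DirProd_group A.group_axioms B.group_axioms)
  note mem = mem_cocycle_stabilizer_iff[OF Q \<alpha>]
  have carA: "carrier (QuandleAut Q) = quandle_auto Q" by (simp add: QuandleAut_def)
  have mulA: "f \<otimes>\<^bsub>QuandleAut Q\<^esub> g = f \<otimes>\<^bsub>BijGroup (carrier Q)\<^esub> g" for f g
    by (simp add: QuandleAut_def)
  have auto: "\<phi> \<in> Bij (carrier Q)" if "\<phi> \<in> quandle_auto Q" for \<phi>
    using that by (simp add: quandle_auto_def)
  note \<alpha>B = constant_cocycle_Bij[OF \<alpha>]
  have "subgroup ?C ?G"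
  proof
    show "?C \<subseteq> carrier ?G"
      by (auto simp: mem carA carrier_BijGroup)
  next
    fix p q assume "p \<in> ?C" "q \<in> ?C"
    then obtain f \<theta> g \<eta> where pq: "p = (f, \<theta>)" "q = (g, \<eta>)"
      and f: "(f, \<theta>) \<in> ?C" and g: "(g, \<eta>) \<in> ?C"
      by (metis surj_pair)
    have F: "f \<in> quandle_auto Q" "\<theta> \<in> Bij S" and G: "g \<in> quandle_auto Q" "\<eta> \<in> Bij S"
      using f g by (auto simp: mem)
    have "f \<otimes>\<^bsub>QuandleAut Q\<^esub> g \<in> quandle_auto Q" "\<theta> \<otimes>\<^bsub>BijGroup S\<^esub> \<eta> \<in> Bij S"
      using A.m_closed[of f g] B.m_closed[of \<theta> \<eta>] F G by (simp_all add: carA carrier_BijGroup)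
    \<comment> \<open>Move \<eta> past \<alpha> first, replacing (x, y) by (g x, g y), then move
      \<theta> past the result. The fact \<open>Bij_closed[OF \<alpha>B]\<close> keeps the
      intermediate values in \<open>S\<close>, where products may be evaluated.\<close>
    then show "p \<otimes>\<^bsub>?G\<^esub> q \<in> ?C"
      using f g by (auto simp: pq mem mulA BijGroup_mult_apply auto Bij_closed Bij_closed[OF \<alpha>B])
  next
    have "\<one>\<^bsub>QuandleAut Q\<^esub> \<in> quandle_auto Q" "\<one>\<^bsub>BijGroup S\<^esub> \<in> Bij S"
      using A.one_closed B.one_closed by (simp_all add: carA carrier_BijGroup)
    then show "\<one>\<^bsub>?G\<^esub> \<in> ?C"
      by (auto simp: mem QuandleAut_def BijGroup_def Bij_closed[OF \<alpha>B])
  next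
    fix p assume "p \<in> ?C"
    then obtain f \<theta> where p: "p = (f, \<theta>)" and f: "(f, \<theta>) \<in> ?C"
      by (metis surj_pair)
    have F: "f \<in> quandle_auto Q" "\<theta> \<in> Bij S"
      and eq: "\<And>x y t. \<lbrakk>x \<in> carrier Q; y \<in> carrier Q; t \<in> S\<rbrakk>
        \<Longrightarrow> \<theta> (\<alpha> (x, y) t) = \<alpha> (f x, f y) (\<theta> t)"
      using f by (auto simp: mem)
    let ?i = "inv\<^bsub>BijGroup (carrier Q)\<^esub> f" and ?j = "inv\<^bsub>BijGroup S\<^esub> \<theta>"
    have inv: "inv\<^bsub>QuandleAut Q\<^esub> f = ?i" by (rule QuandleAut_inv[OF closed F(1)])
    have i: "?i \<in> quandle_auto Q" using A.inv_closed[of f] F(1) by (simp add: carA inv)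
    have j: "?j \<in> Bij S" by (rule BijGroup_inv_closed[OF F(2)])
    have "?j (\<alpha> (x, y) t) = \<alpha> (?i x, ?i y) (?j t)"
      if "x \<in> carrier Q" "y \<in> carrier Q" "t \<in> S" for x y t
    proof -
      have c: "?i x \<in> carrier Q" "?i y \<in> carrier Q" "?j t \<in> S"
        using i j that by (simp_all add: Bij_closed auto)
      \<comment> \<open>This is the relation for \<open>f\<close> and \<theta> at the inverse images
        of x, y and t; applying \<open>?j\<close> to both sides gives the relation for the
        inverses.\<close>
      have "\<alpha> (x, y) t = \<theta> (\<alpha> (?i x, ?i y) (?j t))"
        using that c eq[OF c] auto[OF F(1)] F(2) by (simp add: BijGroup_inv_apply)
      then show ?thesis
        using c F(2) by (simp add: BijGroup_inv_apply Bij_closed[OF \<alpha>B])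
    qed
    then have "(?i, ?j) \<in> ?C" using i j by (simp add: mem)
    then show "inv\<^bsub>?G\<^esub> p \<in> ?C"
      using F by (simp add: p inv_DirProd A.group_axioms B.group_axioms carA carrier_BijGroup inv)
  qed
  then have "group (?G\<lparr>carrier := ?C\<rparr>)" by (rule G.subgroup_imp_group)
  then show ?thesis by (simp add: cocycle_stabilizer_def)
qed

section \<open>The embedding by product maps\<close>

theorem theorem7p3:
  fixes Q :: "('a, 'm) magma_scheme" and S :: "'s set"
    and \<alpha> :: "'a \<times> 'a \<Rightarrow> 's \<Rightarrow> 's"
  assumes "quandle Q"
    and "carrier Q \<noteq> {}"
    and "S \<noteq> {}"
    and "\<alpha> \<in> constant_cocycles Q S"
  shows "\<exists>h. group_hom (cocycle_stabilizer Q S \<alpha>) (QuandleAut (quandle_ext Q \<alpha> S)) h \<and>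
    inj_on h (carrier (cocycle_stabilizer Q S \<alpha>))"
proof -
  let ?E = "quandle_ext Q \<alpha> S"
  let ?C = "cocycle_stabilizer Q S \<alpha>"
  \<comment> \<open>The restriction makes the product map extensional on Q x S, as membership in
    \<open>Bij\<close> demands.\<close>
  define h :: "('a \<Rightarrow> 'a) \<times> ('s \<Rightarrow> 's) \<Rightarrow> 'a \<times> 's \<Rightarrow> 'a \<times> 's"
    where "h = (\<lambda>(\<phi>, \<theta>). restrict (map_prod \<phi> \<theta>) (carrier Q \<times> S))"
  note mem = mem_cocycle_stabilizer_iff[OF assms(1,4)]
  have carE: "carrier ?E = carrier Q \<times> S" by (simp add: quandle_ext_def)
  have C: "\<phi> \<in> Bij (carrier Q)" "\<theta> \<in> Bij S" if "(\<phi>, \<theta>) \<in> carrier ?C" for \<phi> \<theta>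
    using that by (auto simp: mem quandle_auto_def)
  have hB: "h (\<phi>, \<theta>) \<in> Bij (carrier Q \<times> S)" if "(\<phi>, \<theta>) \<in> carrier ?C" for \<phi> \<theta>
    using C[OF that]
    by (auto simp: h_def Bij_def intro: bij_betw_map_prod)
  \<comment> \<open>In the first coordinate this is multiplicativity of \<phi>; in the second it is
    the intertwining condition from \<open>mem\<close>.\<close>
  have hE: "h (\<phi>, \<theta>) \<in> quandle_auto ?E" if "(\<phi>, \<theta>) \<in> carrier ?C" for \<phi> \<theta>
    using hB[OF that] that C[OF that] quandle.qop_closed[OF assms(1)]
      quandle_ext_closed[OF assms(1,4)]
    by (auto simp: quandle_auto_def carE mem) (auto simp: h_def quandle_ext_def Bij_closed)
  have "group_hom ?C (QuandleAut ?E) h"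
  proof (intro group_hom.intro group_hom_axioms.intro homI)
    show "group ?C" by (rule group_cocycle_stabilizer[OF assms(1,4)])
    show "group (QuandleAut ?E)"
      by (rule group_QuandleAut[OF quandle_ext_closed[OF assms(1,4)]])
  next
    fix p assume "p \<in> carrier ?C"
    then show "h p \<in> carrier (QuandleAut ?E)"
      using hE by (cases p) (simp add: QuandleAut_def)
  next
    fix p q assume pq: "p \<in> carrier ?C" "q \<in> carrier ?C"
    obtain f \<theta> g \<eta> where e: "p = (f, \<theta>)" "q = (g, \<eta>)" by (metis surj_pair)
    \<comment> \<open>The product of \<open>BijGroup\<close> is itself restricted to
      \<open>Bij\<close>, so it unfolds to \<open>compose\<close> only once both factors are known
      to lie there.\<close>
    have "h p \<in> Bij (carrier Q \<times> S)" "h q \<in> Bij (carrier Q \<times> S)"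
      using hB pq by (simp_all add: e)
    then have hh: "h p \<otimes>\<^bsub>QuandleAut ?E\<^esub> h q = compose (carrier Q \<times> S) (h p) (h q)"
      by (simp add: QuandleAut_def carE BijGroup_def)
    have B: "f \<in> Bij (carrier Q)" "\<theta> \<in> Bij S" "g \<in> Bij (carrier Q)" "\<eta> \<in> Bij S"
      using C pq by (simp_all add: e)
    then have "p \<otimes>\<^bsub>?C\<^esub> q = (compose (carrier Q) f g, compose S \<theta> \<eta>)"
      by (simp add: e cocycle_stabilizer_def QuandleAut_def BijGroup_def)
    then show "h (p \<otimes>\<^bsub>?C\<^esub> q) = h p \<otimes>\<^bsub>QuandleAut ?E\<^esub> h q"
      unfolding hh using B by (auto simp: e h_def compose_def restrict_def Bij_closed)
  qed
  moreover have "inj_on h (carrier ?C)"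
  proof (rule inj_onI)
    fix p q assume pq: "p \<in> carrier ?C" "q \<in> carrier ?C" and eq: "h p = h q"
    obtain f \<theta> g \<eta> where e: "p = (f, \<theta>)" "q = (g, \<eta>)" by (metis surj_pair)
    have pt: "f x = g x \<and> \<theta> t = \<eta> t" if "x \<in> carrier Q" "t \<in> S" for x t
      using fun_cong[OF eq, of "(x, t)"] that by (simp add: e h_def)
    have "f \<in> Bij (carrier Q)" "g \<in> Bij (carrier Q)" "\<theta> \<in> Bij S" "\<eta> \<in> Bij S"
      using C pq by (simp_all add: e)
    \<comment> \<open>The fact \<open>pt\<close> needs a point of each set: comparing
      \<open>f\<close> and \<open>g\<close> at x takes some t in \<open>S\<close>, and comparing
      \<theta> and \<eta> at t takes some x in Q.\<close>
    then have "f = g" "\<theta> = \<eta>"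
      using pt assms(2,3) by (blast intro: Bij_eqI)+
    then show "p = q" by (simp add: e)
  qed
  ultimately show ?thesis by blast
qed

end
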